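(* Let $F$ be a field of characteristic $0$ and let $r\geq 1$ be an integer. Let $R$ be a nonzero Rota--Baxter operator of weight $1$ on $F[x,y]$ with $R(x^n y^m) = \alpha_{n,m} x^{rm} y^m$ for some $\alpha_{n,m}\in F$ ($n,m\in\mathbb{N}$) and $\mathrm{Im}\,R\neq F$. Then $R$ has the following form: $$R(x^n y^m) = \begin{cases} -(-\alpha_{0, 1})^{\frac{rm - n}{r}}x^{r m} y^m, & m > 0, \\ \theta(-\alpha_{1, 0})^n, & m = 0, \end{cases}$$ where $\theta\in \{0, -1\}$. Here $\alpha_{0,1}\neq 0$ and the expression $(-\alpha_{0, 1})^{\frac{rm - n}{r}}$ means $(-\alpha_{0, 1})^m\rho^n$ for some fixed $\rho\in F$ (independent of $n,m$) with $\rho^r=-1/\alpha_{0,1}$.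
   Context: $\mathbb{N}=\{0,1,2,\ldots\}$, and $\mu^0=1$ for every $\mu\in F$ (in particular $0^0=1$). $F$ is identified with the constant polynomials. A linear operator $R$ on an algebra $A$ over $F$ is a Rota--Baxter operator of weight $\lambda\in F$ if $R(a)R(b)=R\big(R(a)b+aR(b)+\lambda ab\big)$ for all $a,b\in A$. *)

theory Defs
  imports Complex_Main "HOL-Computational_Algebra.Polynomial"
begin

locale algebra_over_field = vector_space scale
  for scale :: "'f::field \<Rightarrow> 'a::ring \<Rightarrow> 'a" (infixr "*s" 75) +
  assumes scale_mult_left: "(c *s a) * b = c *s (a * b)"
    and scale_mult_right: "a * (c *s b) = c *s (a * b)"

locale rota_baxter_operator = algebra_over_field scale
  for scale :: "'f::field \<Rightarrow> 'a::ring \<Rightarrow> 'a" (infixr "*s" 75) +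
  fixes wt :: 'f and R :: "'a \<Rightarrow> 'a"
  assumes linear_R: "Vector_Spaces.linear scale scale R"
    and rota_baxter: "R a * R b = R (R a * b + a * R b + wt *s (a * b))"

text \<open>
  The algebra $F[x,y]$ is represented as $F[x][y]$, that is, by the type \<^typ>\<open>'f poly poly\<close>:
  the outer indeterminate is $y$, and the coefficients are polynomials in $x$.
\<close>

type_synonym 'f poly_xy = "'f poly poly"

definition const_xy :: "'f::field \<Rightarrow> 'f poly_xy" where
  "const_xy c = [:[:c:]:]"

definition X :: "'f::field poly_xy" where
  "X = [:[:0, 1:]:]"

definition Y :: "'f::field poly_xy" where
  "Y = [:0, 1:]"

definition scale_xy :: "'f::field \<Rightarrow> 'f poly_xy \<Rightarrow> 'f poly_xy" where
  "scale_xy c p = smult [:c:] p"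

lemma scale_xy_conv_mult: "scale_xy c p = const_xy c * p"
  by (simp add: scale_xy_def const_xy_def)

lemma X_power_times_Y_power: "X ^ n * Y ^ m = monom (monom 1 n) m"
proof -
  show ?thesis
    by (simp add: X_def Y_def poly_const_pow monom_altdef)
qed

interpretation poly_xy: algebra_over_field scale_xy
  by unfold_locales
    (simp_all add: scale_xy_def smult_add_right mult.commute flip: one_pCons smult_add_left)

end

theory Submission
  imports Defs
begin

text \<open>
  Write \<open>b n m = - \<alpha> n m\<close>. Conceptually, the theorem says that on the multiples of \<open>y\<close> the operator
  \<open>-R\<close> is the substitution \<open>f(x, y) \<mapsto> f(\<rho>, b\<^sub>0\<^sub>1 x\<^sup>r y)\<close>, which is idempotent
  because \<open>b\<^sub>0\<^sub>1 \<rho>\<^sup>r = 1\<close>, and on polynomials in \<open>x\<close> it is zero or the evaluation at \<open>b\<^sub>1\<^sub>0\<close>.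

  Comparing coefficients in the Rota--Baxter identity for two monomials turns it into a quadratic
  recurrence for \<open>b\<close>. When the second monomial is a power of \<open>x\<close>, the recurrence stays inside
  one column \<open>m\<close> and reads \<open>b (n + k) m = b n m * b (r * m + k) m\<close>. This is the functional
  equation of an exponential function with a shifted origin, so the column either vanishes or is
  geometric in \<open>n\<close>, normalised to \<open>1\<close> at \<open>n = r * m\<close>
  (\<open>shifted_exponential\<close>). For \<open>m = 0\<close> this is already the claim about powers of \<open>x\<close>.

  It remains to compare the columns with \<open>m > 0\<close>. Evaluated at the normalised places \<open>n = r * m\<close>,
  \<open>k = r * l\<close>, the recurrence shows that columns \<open>m\<close> and \<open>l\<close> of the same kind (both zero or both
  nonzero) force the same kind on column \<open>m + l\<close>, so all positive columns are of the kind of column \<open>1\<close>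
  (\<open>normal_entry_eq\<close>). One step further, at \<open>n = r * m + 1\<close>, \<open>k = r * l + 1\<close>, it says
  that the ratios satisfy \<open>(\<rho>\<^sub>m - \<rho>\<^sub>m\<^sub>+\<^sub>l) (\<rho>\<^sub>l - \<rho>\<^sub>m\<^sub>+\<^sub>l) = 0\<close>, so that all ratios agree
  with that of column \<open>1\<close> (\<open>ratio_eq\<close>). Finally, some positive column is nonzero: otherwise
  \<open>R\<close> takes only constant values, and being nonzero its image would be \<open>F\<close>.
\<close>

section \<open>The recurrence for the coefficients\<close>

text \<open>
  Taking \<open>k = 0\<close> shows that \<open>b s = 1\<close> unless \<open>b\<close> vanishes, and \<open>k = 1\<close> gives the constant ratio.
\<close>

lemma shifted_exponential:
  fixes b :: "nat \<Rightarrow> 'f::field"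
  assumes shift: "\<And>n k. b (n + k) = b n * b (s + k)"
    and "b j \<noteq> 0"
  shows "b s = 1" and "b n = b 0 * b (s + 1) ^ n"
proof -
  show "b s = 1"
    using shift[of j 0] \<open>b j \<noteq> 0\<close> by simp
  show "b n = b 0 * b (s + 1) ^ n"
  proof (induction n)
    case (Suc n)
    then show ?case using shift[of n 1] by simp
  qed simp
qed

locale monomial_rota_baxter_coeffs =
  fixes r :: nat and b :: "nat \<Rightarrow> nat \<Rightarrow> 'f::field"
  assumes recurrence:
    "b n m * b k l = b n m * b (r * m + k) (m + l) + b k l * b (n + r * l) (m + l) - b (n + k) (m + l)"
begin

lemma column_shift: "b (n + k) m = b n m * b (r * m + k) m"
  using recurrence[of n m k 0] by (simp add: algebra_simps)

lemma normal_entry: "b (r * m) m = (if \<forall>n. b n m = 0 then 0 else 1)"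
  using shifted_exponential(1)[where b = "\<lambda>n. b n m", OF column_shift] by auto

text \<open>
  With \<open>e\<^sub>m = b (r * m) m\<close>, which is \<open>0\<close> or \<open>1\<close>, the recurrence between the normalised places is
  \<open>e\<^sub>m e\<^sub>l = (e\<^sub>m + e\<^sub>l - 1) e\<^sub>m\<^sub>+\<^sub>l\<close>; the bracket is \<open>-1\<close> or \<open>1\<close> when \<open>e\<^sub>m = e\<^sub>l\<close>.
\<close>

lemma normal_entry_add:
  assumes "b (r * m) m = b (r * l) l"
  shows "b (r * (m + l)) (m + l) = b (r * m) m"
proof -
  have "b (r * l) l * b (r * l) l = (2 * b (r * l) l - 1) * b (r * (m + l)) (m + l)"
    using recurrence[of "r * m" m "r * l" l] assms by (simp add: algebra_simps)
  then show ?thesis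
    unfolding assms by (simp add: normal_entry[of l] split: if_splits)
qed

lemma normal_entry_eq:
  assumes "m \<ge> 1"
  shows "b (r * m) m = b r 1"
  using assms
proof (induction m rule: dec_induct)
  case (step m)
  then show ?case using normal_entry_add[of m 1] by simp
qed simp

lemma nonzero_column:
  assumes "b i j \<noteq> 0" and "j \<ge> 1" and "m \<ge> 1"
  shows "b (r * m) m = 1"
  using normal_entry[of j] normal_entry_eq[of j] normal_entry_eq[of m] assms by auto

text \<open>
  The entry right after a normalised \<open>1\<close> is the ratio of its column, which makes the recurrence at
  these entries the expanded form of the product below.
\<close>

lemma ratio_add:
  assumes "b (r * m) m = 1" and "b (r * l) l = 1" and "b (r * (m + l)) (m + l) = 1"
  shows "(b (r * m + 1) m - b (r * (m + l) + 1) (m + l)) *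
    (b (r * l + 1) l - b (r * (m + l) + 1) (m + l)) = 0"
proof -
  have "b (r * (m + l) + 2) (m + l) = b (r * (m + l) + 1) (m + l) ^ 2"
    using column_shift[of "r * (m + l) + 1" 1 "m + l"] by (simp add: power2_eq_square)
  then show ?thesis
    using recurrence[of "r * m + 1" m "r * l + 1" l]
    by (simp add: algebra_simps power2_eq_square)
qed

lemma ratio_eq:
  assumes "b i j \<noteq> 0" and "j \<ge> 1" and "m \<ge> 1"
  shows "b (r * m + 1) m = b (r + 1) 1"
  using \<open>m \<ge> 1\<close>
proof (induction m rule: dec_induct)
  case (step m)
  then show ?case
    using ratio_add[of m 1] nonzero_column[OF assms(1,2), of m]
      nonzero_column[OF assms(1,2), of 1] nonzero_column[OF assms(1,2), of "m + 1"] by simp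
qed simp

text \<open>
  The two unknowns \<open>b 0 m\<close> and the ratio of the column are tied together by the normalisation
  \<open>b (r * m) m = 1\<close>; as the ratio is common to all columns, \<open>b 0 m\<close> is determined by \<open>b 0 1\<close>.
\<close>

lemma positive_columns:
  assumes "b i j \<noteq> 0" and "j \<ge> 1"
  shows "b 0 1 * b (r + 1) 1 ^ r = 1"
    and "m \<ge> 1 \<Longrightarrow> b n m = b 0 1 ^ m * b (r + 1) 1 ^ n"
proof -
  define \<rho> where "\<rho> = b (r + 1) 1"
  have geometric: "b n m = b 0 m * \<rho> ^ n" if "m \<ge> 1" for n m
    using shifted_exponential(2)[where b = "\<lambda>n. b n m", OF column_shift, of "r * m" n]
      nonzero_column[OF assms that] ratio_eq[OF assms that] by (simp add: \<rho>_def)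
  have normal: "b 0 m * \<rho> ^ (r * m) = 1" if "m \<ge> 1" for m
    using nonzero_column[OF assms that] geometric[OF that] by metis
  show first: "b 0 1 * b (r + 1) 1 ^ r = 1"
    using normal[of 1] by (simp add: \<rho>_def)
  show "b n m = b 0 1 ^ m * b (r + 1) 1 ^ n" if "m \<ge> 1"
  proof -
    have "b 0 1 ^ m * \<rho> ^ (r * m) = 1"
      using first by (simp add: \<rho>_def power_mult flip: power_mult_distrib)
    then have "b 0 m = b 0 1 ^ m"
      using normal[OF that] by (metis mult_right_cancel mult_zero_right zero_neq_one)
    then show ?thesis
      using geometric[OF that, of n] by (simp add: \<rho>_def)
  qed
qed

lemma zeroth_column:
  obtains \<theta> where "\<theta> \<in> {0, - 1}" and "\<And>n. - b n 0 = \<theta> * b 1 0 ^ n"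
proof (cases "\<forall>n. b n 0 = 0")
  case True
  then show ?thesis using that[of 0] by simp
next
  case False
  then obtain i where i: "b i 0 \<noteq> 0" by blast
  note exponential = shifted_exponential[where b = "\<lambda>n. b n 0", OF column_shift i]
  have "b 0 0 = 1" using exponential(1) by simp
  then have "- b n 0 = - 1 * b 1 0 ^ n" for n
    using exponential(2)[of n] by simp
  then show ?thesis using that by blast
qed

end

section \<open>Operators on monomials\<close>

lemma span_monomials: "poly_xy.span (range (\<lambda>(n, m). X ^ n * Y ^ m)) = (UNIV :: 'f::field poly_xy set)"
  (is "poly_xy.span ?M = _")
proof -
  have monomial: "monom (monom c n) m \<in> poly_xy.span ?M" for c :: 'f and n m
  proof -
    have "X ^ n * Y ^ m \<in> ?M" by auto
    then have "scale_xy c (X ^ n * Y ^ m) \<in> poly_xy.span ?M"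
      by (intro poly_xy.span_scale poly_xy.span_base)
    then show ?thesis
      by (simp add: X_power_times_Y_power scale_xy_def smult_monom)
  qed
  have "monom q m \<in> poly_xy.span ?M" for q :: "'f poly" and m
  proof -
    have "monom q m = (\<Sum>i\<le>degree q. monom (monom (coeff q i) i) m)"
      by (subst (1) poly_as_sum_of_monoms[of q, symmetric]) (rule monom_sum)
    also have "\<dots> \<in> poly_xy.span ?M"
      by (intro poly_xy.span_sum monomial)
    finally show ?thesis .
  qed
  then have "p \<in> poly_xy.span ?M" for p
    by (subst poly_as_sum_of_monoms[of p, symmetric]) (intro poly_xy.span_sum)
  then show ?thesis by blast
qed

lemma scale_xy_monomial_eq_iff:
  "scale_xy c (X ^ n * Y ^ m) = scale_xy d (X ^ n * Y ^ m) \<longleftrightarrow> c = (d :: 'f::field)"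
  by (simp add: X_power_times_Y_power scale_xy_def smult_monom)

lemma range_const_xy_subspace: "poly_xy.subspace (range (const_xy :: 'f::field \<Rightarrow> _))"
proof (rule poly_xy.subspaceI)
  show "0 \<in> range (const_xy :: 'f \<Rightarrow> _)"
    by (rule range_eqI[of _ _ 0]) (simp add: const_xy_def)
next
  fix p q :: "'f poly_xy"
  assume "p \<in> range const_xy" "q \<in> range const_xy"
  then obtain c d where "p = const_xy c" "q = const_xy d" by auto
  then have "p + q = const_xy (c + d)" by (simp add: const_xy_def)
  then show "p + q \<in> range const_xy" by simp
next
  fix a and p :: "'f poly_xy"
  assume "p \<in> range const_xy"
  then obtain c where "p = const_xy c" by auto
  then have "scale_xy a p = const_xy (a * c)" by (simp add: const_xy_def scale_xy_def)
  then show "scale_xy a p \<in> range const_xy" by simp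
qed

text \<open>
  The image of \<open>R\<close> is a nonzero subspace of the constants, which are one-dimensional.
\<close>

lemma range_eq_constants:
  assumes linear: "Vector_Spaces.linear scale_xy scale_xy R"
    and "R \<noteq> (\<lambda>_. 0)"
    and constants: "\<And>n m. R (X ^ n * Y ^ m) \<in> range const_xy"
  shows "range R = range (const_xy :: 'f::field \<Rightarrow> _)"
proof
  interpret R: Vector_Spaces.linear scale_xy scale_xy R by (rule linear)
  have "poly_xy.subspace (R -` range const_xy)"
    by (rule R.subspace_vimage[OF range_const_xy_subspace])
  then have "poly_xy.span (range (\<lambda>(n, m). X ^ n * Y ^ m)) \<subseteq> R -` range const_xy"
    using constants by (intro poly_xy.span_minimal) auto
  then show sub: "range R \<subseteq> range const_xy"
    unfolding span_monomials by blast
  obtain p where "R p \<noteq> 0" using \<open>R \<noteq> (\<lambda>_. 0)\<close> by blast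
  moreover obtain c where c: "R p = const_xy c" using sub by blast
  ultimately have "c \<noteq> 0" by (auto simp: const_xy_def)
  then have "const_xy d = R (scale_xy (d / c) p)" for d
    by (simp add: R.scale c) (simp add: const_xy_def scale_xy_def)
  then show "range const_xy \<subseteq> range R" by blast
qed

lemma rota_baxter_monomial_coeffs:
  assumes "rota_baxter_operator scale_xy 1 R"
    and R: "\<And>n m. R (X ^ n * Y ^ m) = scale_xy (\<alpha> n m) (X ^ (r * m) * Y ^ m)"
  shows "monomial_rota_baxter_coeffs r (\<lambda>n m. - \<alpha> n m :: 'f::field)"
proof
  interpret rota_baxter_operator scale_xy 1 R by fact
  interpret R: Vector_Spaces.linear scale_xy scale_xy R by (rule linear_R)
  fix n m k l
  let ?x = "X ^ n * Y ^ m :: 'f poly_xy" and ?z = "X ^ k * Y ^ l :: 'f poly_xy"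
  let ?w = "X ^ (r * (m + l)) * Y ^ (m + l) :: 'f poly_xy"
  have monomial_mult:
    "(X ^ i * Y ^ j) * (X ^ i' * Y ^ j') = (X ^ (i + i') * Y ^ (j + j') :: 'f poly_xy)" for i j i' j'
    by (simp add: power_add mult_ac)
  have "scale_xy (\<alpha> n m * \<alpha> k l) ?w = R ?x * R ?z"
    by (simp add: R poly_xy.scale_mult_left poly_xy.scale_mult_right monomial_mult distrib_left)
  also have "\<dots> = R (R ?x * ?z + ?x * R ?z + scale_xy 1 (?x * ?z))"
    by (rule rota_baxter)
  also have "\<dots> = scale_xy (\<alpha> n m * \<alpha> (r * m + k) (m + l) + \<alpha> k l * \<alpha> (n + r * l) (m + l)
      + \<alpha> (n + k) (m + l)) ?w"
    by (simp add: R poly_xy.scale_mult_left poly_xy.scale_mult_right monomial_mult R.add R.scale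
        poly_xy.scale_left_distrib)
  finally have "\<alpha> n m * \<alpha> k l = \<alpha> n m * \<alpha> (r * m + k) (m + l) + \<alpha> k l * \<alpha> (n + r * l) (m + l)
      + \<alpha> (n + k) (m + l)"
    by (simp only: scale_xy_monomial_eq_iff)
  then show "- \<alpha> n m * - \<alpha> k l = - \<alpha> n m * - \<alpha> (r * m + k) (m + l)
      + - \<alpha> k l * - \<alpha> (n + r * l) (m + l) - - \<alpha> (n + k) (m + l)"
    by simp
qed

section \<open>The classification\<close>

theorem lemma6p2:
  fixes R :: "'f::field_char_0 poly_xy \<Rightarrow> 'f poly_xy"
    and \<alpha> :: "nat \<Rightarrow> nat \<Rightarrow> 'f"
    and r :: nat
  assumes "r \<ge> 1"
    and "rota_baxter_operator scale_xy 1 R"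
    and "R \<noteq> (\<lambda>_. 0)"
    and "\<And>n m. R (X ^ n * Y ^ m) = scale_xy (\<alpha> n m) (X ^ (r * m) * Y ^ m)"
    and "range R \<noteq> range const_xy"
  shows "\<alpha> 0 1 \<noteq> 0 \<and>
    (\<exists>\<rho> \<theta>. \<rho> ^ r = - 1 / \<alpha> 0 1 \<and> \<theta> \<in> {0, - 1} \<and>
      (\<forall>n m. R (X ^ n * Y ^ m) =
        (if m > 0 then scale_xy (- ((- \<alpha> 0 1) ^ m * \<rho> ^ n)) (X ^ (r * m) * Y ^ m)
         else const_xy (\<theta> * (- \<alpha> 1 0) ^ n))))"
proof -
  note R = assms(4)
  interpret monomial_rota_baxter_coeffs r "\<lambda>n m. - \<alpha> n m"
    using assms(2) R by (rule rota_baxter_monomial_coeffs)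
  have "\<exists>n m. m \<ge> 1 \<and> \<alpha> n m \<noteq> 0"
  proof (rule ccontr)
    assume none: "\<not> (\<exists>n m. m \<ge> 1 \<and> \<alpha> n m \<noteq> 0)"
    have "R (X ^ n * Y ^ m) = const_xy (if m = 0 then \<alpha> n 0 else 0)" for n m
    proof (cases "m = 0")
      case False
      with none have "\<alpha> n m = 0" by auto
      with False show ?thesis by (simp add: R scale_xy_conv_mult const_xy_def)
    next
      case True
      then show ?thesis using R[of n 0] by (simp add: scale_xy_conv_mult)
    qed
    then have "range R = range const_xy"
      using assms(2,3)
      by (intro range_eq_constants) (auto simp: rota_baxter_operator_def rota_baxter_operator_axioms_def)
    then show False using assms(5) by contradiction
  qed
  then obtain i j where "- \<alpha> i j \<noteq> 0" "j \<ge> 1" by auto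
  note columns = positive_columns[OF this]
  define \<rho> where "\<rho> = - \<alpha> (r + 1) 1"
  have \<rho>: "- \<alpha> 0 1 * \<rho> ^ r = 1"
    using columns(1) by (simp add: \<rho>_def)
  then have nonzero: "\<alpha> 0 1 \<noteq> 0" by auto
  have "\<rho> ^ r * \<alpha> 0 1 = - 1"
    using \<rho> by (metis add.inverse_inverse mult.commute mult_minus_left)
  then have power: "\<rho> ^ r = - 1 / \<alpha> 0 1"
    using nonzero by (metis nonzero_eq_divide_eq)
  obtain \<theta> where \<theta>: "\<theta> \<in> {0, - 1}" "\<And>n. - (- \<alpha> n 0) = \<theta> * (- \<alpha> 1 0) ^ n"
    using zeroth_column by blast
  have "R (X ^ n * Y ^ m) =
      (if m > 0 then scale_xy (- ((- \<alpha> 0 1) ^ m * \<rho> ^ n)) (X ^ (r * m) * Y ^ m)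
       else const_xy (\<theta> * (- \<alpha> 1 0) ^ n))" for n m
  proof (cases "m > 0")
    case True
    then have "- \<alpha> n m = (- \<alpha> 0 1) ^ m * \<rho> ^ n"
      using columns(2)[of m n] by (simp add: \<rho>_def)
    then have "\<alpha> n m = - ((- \<alpha> 0 1) ^ m * \<rho> ^ n)"
      by (metis add.inverse_inverse)
    with True show ?thesis by (simp only: R if_True)
  next
    case False
    then show ?thesis using R[of n 0] \<theta>(2)[of n] by (simp add: scale_xy_conv_mult)
  qed
  with nonzero power \<theta>(1) show ?thesis by blast
qed

end
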